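(* For all $M,n\in\mathbb N$ with $M>1$ or $n>1$, $$A(n,M)=\varphi(M)\sum_{d\mid M} A(n-1,d)\left(\frac{M}{d}\right)^{n-1},$$ where the sum runs over the positive divisors $d$ of $M$.
   Context: Let $\chi:\mathbb Q\to\mathbb Q$ be defined by $\chi(x)=x\lceil x\rceil$, where $\lceil x\rceil$ is the smallest integer greater than or equal to $x$. For $x\in\mathbb Q$, $\mathrm{ord}(x)=\min\{k\in\mathbb N_0:\chi^k(x)\in\mathbb Z\}$ if this set is nonempty, and $\mathrm{ord}(x)=\infty$ otherwise ($\mathbb N=\{1,2,\dots\}$, $\mathbb N_0=\mathbb N\cup\{0\}$). For $n\in\mathbb N_0$ and $M\in\mathbb N$, let $\mathcal A_{n,M}=\{a\in\mathbb Z:\gcd(a,M)=1,\ \mathrm{ord}(a/M)=n\}$; this set is a union of congruence classes modulo $M^{n+1}$, and $A(n,M)$ denotes the number of congruence classes modulo $M^{n+1}$ contained in $\mathcal A_{n,M}$ (so $A(0,1)=1$, $A(n,1)=0$ for $n\ge1$, $A(0,M)=0$ for $M>1$). $\varphi$ is Euler's totient function. *)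

theory Defs
  imports "HOL-Number_Theory.Number_Theory" "HOL-Library.Extended_Nat"
begin

definition chi :: "rat \<Rightarrow> rat" where
  "chi x = x * of_int \<lceil>x\<rceil>"

definition chi_ord :: "rat \<Rightarrow> enat" where
  "chi_ord x =
     (if \<exists>k. (chi ^^ k) x \<in> \<int> then enat (LEAST k. (chi ^^ k) x \<in> \<int>) else \<infinity>)"

definition A_set :: "nat \<Rightarrow> nat \<Rightarrow> int set" where
  "A_set n M = {a. gcd a (int M) = 1 \<and> chi_ord (of_int a / of_nat M) = enat n}"

definition cong_classes :: "int \<Rightarrow> int set set" where
  "cong_classes m = UNIV // {(a, b). [a = b] (mod m)}"

definition A_count :: "nat \<Rightarrow> nat \<Rightarrow> nat" where
  "A_count n M = card {C \<in> cong_classes (int M ^ (n + 1)). C \<subseteq> A_set n M}"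

end

theory Submission
  imports Defs
begin

text \<open>
  Write a numerator as \<open>a = c M - r\<close> with \<open>0 \<le> r < M\<close>, so that \<open>c\<close> is the ceiling of \<open>a/M\<close>.
  With \<open>g = gcd c M\<close>, \<open>d = M/g\<close> and \<open>c = g e\<close>, one step of \<open>\<chi>\<close> produces the reduced fraction
  \<open>(c M - r) e / d\<close>. As a function of \<open>e\<close> its numerator is \<open>g\<^sup>2 d e\<^sup>2 - r e\<close>, and
  this quadratic permutes the residues modulo every power of \<open>d\<close>, since \<open>r\<close> is a unit modulo \<open>d\<close>.
  Hence for every unit \<open>r\<close> and every divisor \<open>d\<close>, each of the classes modulo \<open>d\<^sup>n\<close>
  counted by \<open>A(n-1,d)\<close> arises from exactly \<open>(M/d)\<^bsup>n-1\<^esup>\<close> residues \<open>c\<close> modulo \<open>M\<^sup>n\<close>.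
\<close>

subsection \<open>Counting in sets of residue classes\<close>

text \<open>Makes "union of congruence classes modulo \<open>N\<close>" precise. One implication is
  enough because congruence is symmetric.\<close>

definition periodic_mod :: "int \<Rightarrow> int set \<Rightarrow> bool" where
  "periodic_mod N S \<longleftrightarrow> (\<forall>x y. [x = y] (mod N) \<longrightarrow> x \<in> S \<longrightarrow> y \<in> S)"

lemma periodic_modD: "periodic_mod N S \<Longrightarrow> [x = y] (mod N) \<Longrightarrow> x \<in> S \<longleftrightarrow> y \<in> S"
  unfolding periodic_mod_def using cong_sym by blast

text \<open>As \<open>X\<close> has \<open>N\<close> elements, injectivity of \<open>g\<close>
  modulo \<open>N\<close> makes \<open>g\<close> hit every residue once, and membership in
  \<open>S\<close> depends on the residue only. It is applied to a shifted interval, to the values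
  of a quadratic, and to pairs \<open>(r, c)\<close>.\<close>

lemma card_complete_residue_system:
  fixes N :: int and g :: "'a \<Rightarrow> int"
  assumes per: "periodic_mod N S" and "N > 0" and "finite X" and card: "card X = nat N"
    and inj: "\<And>x y. x \<in> X \<Longrightarrow> y \<in> X \<Longrightarrow> [g x = g y] (mod N) \<Longrightarrow> x = y"
  shows "card {x \<in> X. g x \<in> S} = card (S \<inter> {0..<N})"
proof -
  let ?h = "\<lambda>x. g x mod N"
  have inj_h: "inj_on ?h X"
    using inj by (auto simp: inj_on_def cong_def)
  have sub: "?h ` X \<subseteq> {0..<N}"
    using \<open>N > 0\<close> by auto
  have img: "?h ` X = {0..<N}"
    by (rule card_subset_eq) (use sub card card_image[OF inj_h] in auto)
  have mem: "?h x \<in> S \<longleftrightarrow> g x \<in> S" for x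
    by (rule periodic_modD[OF per]) (simp add: cong_def)
  have "?h ` {x \<in> X. g x \<in> S} = S \<inter> ?h ` X"
    using mem by auto
  moreover have "inj_on ?h {x \<in> X. g x \<in> S}"
    using inj_h by (rule inj_on_subset) auto
  ultimately show ?thesis
    using img card_image by metis
qed

lemma card_periodic_mult:
  fixes N :: int
  assumes per: "periodic_mod N S" and "N > 0"
  shows "card (S \<inter> {0..<int k * N}) = k * card (S \<inter> {0..<N})"
proof (induction k)
  case 0
  then show ?case by simp
next
  case (Suc k)
  \<comment> \<open>The last period, peeled off from the \<open>Suc k\<close> periods;
    \<open>N\<close> consecutive integers form a complete residue system.\<close>
  let ?X = "{int k * N..<int k * N + N}"
  have "card {x \<in> ?X. x \<in> S} = card (S \<inter> {0..<N})"
  proof (rule card_complete_residue_system[OF per \<open>N > 0\<close>])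
    show "x = y" if "x \<in> ?X" "y \<in> ?X" "[x = y] (mod N)" for x y
    proof -
      have "N dvd x - y"
        using that by (simp add: cong_iff_dvd_diff)
      moreover have "\<bar>x - y\<bar> < N"
        using that by auto
      ultimately show ?thesis
        using dvd_imp_le_int[of "x - y" N] by fastforce
    qed
  qed auto
  moreover have "{x \<in> ?X. x \<in> S} = S \<inter> ?X"
    by auto
  moreover have "S \<inter> {0..<int (Suc k) * N} = (S \<inter> {0..<int k * N}) \<union> (S \<inter> ?X)"
  proof -
    have "{0..<int k * N} \<union> ?X = {0..<int k * N + N}"
      using \<open>N > 0\<close> by (intro ivl_disj_un_two(3)) auto
    moreover have "int (Suc k) * N = int k * N + N"
      by (simp add: algebra_simps)
    ultimately show ?thesis
      by (simp only: Int_Un_distrib flip: \<open>_ \<union> _ = _\<close>)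
  qed
  moreover have "card ((S \<inter> {0..<int k * N}) \<union> (S \<inter> ?X)) =
      card (S \<inter> {0..<int k * N}) + card (S \<inter> ?X)"
    by (rule card_Un_disjoint) auto
  ultimately show ?case
    using Suc by simp
qed

text \<open>Turns the quotient in \<open>A_count\<close> into a count of least nonnegative
  representatives, on which all later counting is done.\<close>

lemma card_cong_classes_subset:
  fixes N :: int
  assumes per: "periodic_mod N S" and "N > 0"
  shows "card {C \<in> cong_classes N. C \<subseteq> S} = card (S \<inter> {0..<N})"
proof -
  let ?cl = "\<lambda>a. {b. [a = b] (mod N)}"
  have "bij_betw ?cl (S \<inter> {0..<N}) {C \<in> cong_classes N. C \<subseteq> S}"
    unfolding bij_betw_def
  proof
    show "inj_on ?cl (S \<inter> {0..<N})"
    proof (rule inj_onI)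
      fix a b assume ab: "a \<in> S \<inter> {0..<N}" "b \<in> S \<inter> {0..<N}" "?cl a = ?cl b"
      then have "[a = b] (mod N)"
        by (metis cong_refl mem_Collect_eq)
      with ab show "a = b"
        by (simp add: cong_def)
    qed
    show "?cl ` (S \<inter> {0..<N}) = {C \<in> cong_classes N. C \<subseteq> S}"
    proof (intro equalityI subsetI)
      fix C assume "C \<in> ?cl ` (S \<inter> {0..<N})"
      then show "C \<in> {C \<in> cong_classes N. C \<subseteq> S}"
        using periodic_modD[OF per] by (auto simp: cong_classes_def quotient_def Image_def)
    next
      fix C assume C: "C \<in> {C \<in> cong_classes N. C \<subseteq> S}"
      then obtain a where a: "C = ?cl a"
        by (auto simp: cong_classes_def quotient_def Image_def)
      with C have "a \<in> S" by auto
      then have "a mod N \<in> S"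
        using periodic_modD[OF per, of a "a mod N"] by (simp add: cong_def)
      moreover have "C = ?cl (a mod N)"
        using a by (simp add: cong_def)
      ultimately show "C \<in> ?cl ` (S \<inter> {0..<N})"
        using \<open>N > 0\<close> by (intro image_eqI[of _ _ "a mod N"]) auto
    qed
  qed
  then show ?thesis
    by (metis bij_betw_same_card)
qed

subsection \<open>One step of the iteration\<close>

lemma chi_ord_eq_enat_iff:
  "chi_ord x = enat n \<longleftrightarrow> (chi ^^ n) x \<in> \<int> \<and> (\<forall>k<n. (chi ^^ k) x \<notin> \<int>)"
proof
  assume "chi_ord x = enat n"
  then have ex: "\<exists>k. (chi ^^ k) x \<in> \<int>" and "n = (LEAST k. (chi ^^ k) x \<in> \<int>)"
    by (auto simp: chi_ord_def split: if_splits)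
  then show "(chi ^^ n) x \<in> \<int> \<and> (\<forall>k<n. (chi ^^ k) x \<notin> \<int>)"
    using LeastI_ex[OF ex] not_less_Least by blast
next
  assume *: "(chi ^^ n) x \<in> \<int> \<and> (\<forall>k<n. (chi ^^ k) x \<notin> \<int>)"
  then have "(LEAST k. (chi ^^ k) x \<in> \<int>) = n"
    by (intro Least_equality) (auto simp: not_less[symmetric])
  with * show "chi_ord x = enat n"
    by (auto simp: chi_ord_def)
qed

lemma chi_ord_Suc_iff:
  "chi_ord x = enat (Suc n) \<longleftrightarrow> x \<notin> \<int> \<and> chi_ord (chi x) = enat n"
  unfolding chi_ord_eq_enat_iff
  by (auto simp: less_Suc_eq_0_disj funpow_Suc_right simp del: funpow.simps(2))

text \<open>Modulo \<open>m\<close> the number \<open>k * m - r\<close> is \<open>-r\<close>. This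
  serves both the numerators \<open>c * M - r\<close> and the cofactor in the injectivity of the
  quadratic.\<close>

lemma coprime_mult_diff_iff: "coprime (k * m - r) m \<longleftrightarrow> coprime r m" for k m r :: int
  using gcd_add_mult[of m k "- r"] by (simp add: coprime_iff_gcd_eq_1 gcd.commute)

lemma fraction_notin_Ints:
  fixes a :: int
  assumes "M > 1" and "coprime a (int M)"
  shows "(of_int a / of_nat M :: rat) \<notin> \<int>"
proof
  assume "(of_int a / of_nat M :: rat) \<in> \<int>"
  then obtain k where "(of_int a / of_nat M :: rat) = of_int k"
    by (auto elim: Ints_cases)
  then have "(of_int a :: rat) = of_int (k * int M)"
    using assms by (simp add: field_simps)
  then have "a = k * int M"
    by (simp only: of_int_eq_iff)
  with assms show False
    by (simp add: coprime_mult_left_iff)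
qed

lemma A_set_0: "M \<ge> 1 \<Longrightarrow> A_set 0 M = (if M = 1 then UNIV else {})"
  using fraction_notin_Ints[of M]
  by (auto simp: A_set_def chi_ord_eq_enat_iff coprime_iff_gcd_eq_1)

lemma A_set_Suc_1: "A_set (Suc n) 1 = {}"
  by (auto simp: A_set_def chi_ord_Suc_iff)

text \<open>The ceiling is \<open>c\<close>, so \<open>chi\<close> multiplies by
  \<open>g * e\<close> and the factor \<open>g\<close> cancels against \<open>M = d * g\<close>. The
  result is in lowest terms: \<open>e\<close> is coprime to \<open>d\<close> by the choice of
  \<open>g\<close>, and the old numerator is coprime to \<open>M\<close>.\<close>

lemma A_set_Suc_iff:
  fixes c r e :: int and M d g :: nat
  assumes M: "M > 1" "M = d * g" and r: "0 \<le> r" "r < int M"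
    and g: "gcd c (int M) = int g" and c: "c = int g * e"
  shows "c * int M - r \<in> A_set (Suc n) M \<longleftrightarrow>
    coprime r (int M) \<and> (c * int M - r) * e \<in> A_set n d"
proof -
  let ?a = "c * int M - r"
  let ?x = "of_int ?a / of_nat M :: rat"
  have pos: "d > 0" "g > 0"
    using M by (auto intro: Nat.gr0I)
  have cop_a: "coprime ?a (int M) \<longleftrightarrow> coprime r (int M)"
    by (rule coprime_mult_diff_iff)
  have "int g * gcd e (int d) = gcd (int g * e) (int g * int d)"
    using gcd_mult_distrib_int[of "int g" e "int d"] by simp
  also have "\<dots> = int g"
    using g c M by (simp add: mult.commute)
  finally have cop_e: "coprime e (int d)"
    using pos by (simp add: coprime_iff_gcd_eq_1)
  have x_eq: "?x = of_int c - of_int r / of_nat M"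
    using M(1) by (simp add: field_simps)
  have "(of_int r :: rat) < of_int (int M)"
    using r by (simp only: of_int_less_iff)
  then have "0 \<le> (of_int r / of_nat M :: rat)" "(of_int r / of_nat M :: rat) < 1"
    using r M(1) by simp_all
  then have "\<lceil>?x\<rceil> = c"
    unfolding x_eq by (intro ceiling_unique) auto
  then have "chi ?x = of_int ?a * of_int c / of_nat M"
    by (simp add: chi_def)
  also have "\<dots> = of_int (?a * e) / of_nat d"
    using pos M(2) c by (simp add: field_simps)
  finally have chi: "chi ?x = of_int (?a * e) / of_nat d" .
  have "coprime ?a (int d)" if "coprime r (int M)"
    using that cop_a M(2) by (simp add: coprime_mult_right_iff)
  then have gcd: "coprime (?a * e) (int d)" if "coprime r (int M)"
    using that cop_e by (simp add: coprime_mult_left_iff)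
  have nonint: "?x \<notin> \<int>" if "coprime r (int M)"
    using fraction_notin_Ints[of M ?a] M that cop_a by blast
  show ?thesis
    unfolding A_set_def mem_Collect_eq chi_ord_Suc_iff chi coprime_iff_gcd_eq_1[symmetric]
    using cop_a gcd nonint by blast
qed

lemma ceiling_decomposition:
  fixes a :: int
  assumes "M > 0"
  obtains c r where "a = c * int M - r" "0 \<le> r" "r < int M"
proof
  \<comment> \<open>The ceiling of \<open>a / M\<close> is minus the floor of \<open>-a / M\<close>,
    so division with remainder is applied to \<open>-a\<close>.\<close>
  show "a = (- ((- a) div int M)) * int M - (- a) mod int M"
    by (simp add: minus_div_mult_eq_mod[symmetric])
qed (use assms in auto)

lemma gcd_decomposition:
  fixes c :: int
  assumes "M > (0::nat)"
  obtains d g :: nat and e where "M = d * g" "gcd c (int M) = int g" "c = int g * e"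
proof -
  define g where "g = nat (gcd c (int M))"
  have g: "gcd c (int M) = int g"
    by (simp add: g_def)
  have "int g dvd int M" "int g dvd c"
    by (simp_all flip: g)
  then have "g dvd M" "int g dvd c" by auto
  then show ?thesis
    using that g by (metis dvd_def mult.commute)
qed

text \<open>Adding a multiple of \<open>M ^ (n + 2)\<close> to the numerator keeps \<open>r\<close>
  and \<open>g\<close>, and moves \<open>c\<close> by a multiple of \<open>M ^ (n + 1)\<close> and
  \<open>e\<close> by a multiple of \<open>d * M ^ n\<close>. The next numerator is thus unchanged
  modulo \<open>d ^ (n + 1)\<close>. The induction varies \<open>M\<close> since the denominator
  becomes \<open>d\<close>.\<close>

lemma periodic_A_set: "M \<ge> 1 \<Longrightarrow> periodic_mod (int M ^ Suc n) (A_set n M)"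
proof (induction n arbitrary: M)
  case 0
  then show ?case by (simp add: A_set_0 periodic_mod_def)
next
  case (Suc n)
  show ?case
  proof (cases "M = 1")
    case True
    then show ?thesis by (simp add: periodic_mod_def A_set_Suc_1[simplified])
  next
    case False
    with Suc have M: "M > 1" by simp
    show ?thesis unfolding periodic_mod_def
    proof (intro allI impI)
      fix a a' assume cong: "[a = a'] (mod int M ^ Suc (Suc n))" and a: "a \<in> A_set (Suc n) M"
      obtain c r where cr: "a = c * int M - r" "0 \<le> r" "r < int M"
        using ceiling_decomposition[of M a] M by auto
      obtain d g e where dge: "M = d * g" "gcd c (int M) = int g" "c = int g * e"
        using gcd_decomposition[of M c] M by auto
      have pos: "d > 0" "g > 0"
        using M dge by (auto intro: Nat.gr0I)
      obtain t where t: "a' = a + int M ^ Suc (Suc n) * t"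
        using cong cong_iff_lin by blast
      define c' where "c' = c + int M ^ Suc n * t"
      define e' where "e' = e + int d * int M ^ n * t"
      have a': "a' = c' * int M - r"
        by (simp add: t cr c'_def algebra_simps)
      have c': "c' = int g * e'"
        by (simp add: c'_def e'_def dge algebra_simps)
      have "gcd c' (int M) = gcd c (int M)"
        using gcd_add_mult[of "int M" "int M ^ n * t" c]
        by (simp add: c'_def gcd.commute algebra_simps)
      then have g': "gcd c' (int M) = int g"
        using dge by simp
      \<comment> \<open>\<open>M ^ n\<close> supplies \<open>n\<close> factors \<open>d\<close>, the
        explicit \<open>d\<close> the last one.\<close>
      have "int d ^ Suc n dvd int d * int M ^ n"
        using dge(1) by (simp add: power_mult_distrib)
      then have "[e' = e] (mod int d ^ Suc n)"
        by (simp add: e'_def cong_iff_dvd_diff)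
      moreover have "[a' = a] (mod int d ^ Suc n)"
        using dge(1) by (simp add: t cong_iff_dvd_diff power_mult_distrib)
      ultimately have "[a * e = a' * e'] (mod int d ^ Suc n)"
        by (intro cong_mult) (auto simp: cong_sym)
      moreover have "coprime r (int M)" "a * e \<in> A_set n d"
        using A_set_Suc_iff[OF M dge(1) cr(2,3) dge(2,3)] a cr by auto
      ultimately have "a' * e' \<in> A_set n d"
        using periodic_modD[OF Suc.IH[of d]] pos by auto
      with \<open>coprime r (int M)\<close> show "a' \<in> A_set (Suc n) M"
        using A_set_Suc_iff[OF M dge(1) cr(2,3) g' c'] a' by auto
    qed
  qed
qed

lemma A_count_eq_card: "M \<ge> 1 \<Longrightarrow> A_count n M = card (A_set n M \<inter> {0..<int M ^ Suc n})"
  unfolding A_count_def using card_cong_classes_subset[OF periodic_A_set] by simp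

subsection \<open>The recursion\<close>

text \<open>The difference of two values is \<open>x - y\<close> times a factor congruent to
  \<open>-r\<close> modulo \<open>d\<close>, hence a unit modulo every power of
  \<open>d\<close>.\<close>

lemma quadratic_inj_mod_power:
  fixes u r d x y :: int
  assumes "coprime r d"
    and "[(u * d * x - r) * x = (u * d * y - r) * y] (mod d ^ n)"
  shows "[x = y] (mod d ^ n)"
proof -
  have "(u * d * x - r) * x - (u * d * y - r) * y = (x - y) * (u * (x + y) * d - r)"
    by (simp add: algebra_simps)
  moreover have "coprime (u * (x + y) * d - r) d"
    using assms(1) by (simp only: coprime_mult_diff_iff)
  then have "coprime (d ^ n) (u * (x + y) * d - r)"
    by (simp add: coprime_commute)
  ultimately show ?thesis
    using assms(2) by (simp add: cong_iff_dvd_diff coprime_dvd_mult_left_iff)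
qed

text \<open>Writing \<open>c = g * e\<close>, the bound \<open>M ^ (n + 1)\<close> on
  \<open>c\<close> becomes \<open>g ^ n * d ^ (n + 1)\<close> on \<open>e\<close>: exactly
  \<open>g ^ n\<close> full periods, each contributing \<open>A_count n d\<close>.\<close>

lemma card_ceilings_of_divisor:
  fixes M d g n :: nat and r :: int
  assumes M: "M > 1" "M = d * g" and r: "0 \<le> r" "r < int M" "coprime r (int M)"
  shows "card {c \<in> {0..<int M ^ Suc n}. gcd c (int M) = int g \<and> c * int M - r \<in> A_set (Suc n) M}
    = A_count n d * g ^ n"
proof -
  have pos: "d > 0" "g > 0"
    using M by (auto intro: Nat.gr0I)
  let ?C = "{c \<in> {0..<int M ^ Suc n}. gcd c (int M) = int g \<and> c * int M - r \<in> A_set (Suc n) M}"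
  \<comment> \<open>The new numerator as a function of \<open>e\<close>, with
    \<open>c * M = g * g * d * e\<close>, in the shape of \<open>quadratic_inj_mod_power\<close>
    with \<open>u = g * g\<close>.\<close>
  let ?f = "\<lambda>e. (int (g * g) * int d * e - r) * e"
  let ?N = "int d ^ Suc n"
  let ?S = "{e. ?f e \<in> A_set n d}"
  have N: "?N > 0" using pos by simp
  have cop: "coprime r (int d)"
    using r M by (simp add: coprime_mult_right_iff)
  have per: "periodic_mod ?N (A_set n d)"
    using pos by (intro periodic_A_set) simp
  have MN: "int M ^ Suc n = int g * (int (g ^ n) * ?N)"
    using M by (simp add: power_mult_distrib)
  have f: "?f e = (int g * e * int M - r) * e" for e
    using M by (simp add: algebra_simps)
  have "?C = (\<lambda>e. int g * e) ` (?S \<inter> {0..<int (g ^ n) * ?N})"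
  proof (intro equalityI subsetI)
    fix c assume c: "c \<in> ?C"
    then have "int g dvd c" by (metis (mono_tags, lifting) gcd_dvd1 mem_Collect_eq)
    then obtain e where e: "c = int g * e" by auto
    have "?f e \<in> A_set n d"
      unfolding f using A_set_Suc_iff[OF M r(1,2) _ e] c e by blast
    moreover have "e \<in> {0..<int (g ^ n) * ?N}"
      using c pos unfolding MN e
      by (simp add: zero_le_mult_iff del: of_nat_power power_Suc)
    ultimately show "c \<in> (\<lambda>e. int g * e) ` (?S \<inter> {0..<int (g ^ n) * ?N})"
      using e by auto
  next
    fix c assume "c \<in> (\<lambda>e. int g * e) ` (?S \<inter> {0..<int (g ^ n) * ?N})"
    then obtain e where e: "c = int g * e" "?f e \<in> A_set n d" "e \<in> {0..<int (g ^ n) * ?N}"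
      by blast
    \<comment> \<open>The gcd condition on \<open>c\<close> comes for free: \<open>e\<close> divides
      \<open>?f e\<close>, which is coprime to \<open>d\<close>.\<close>
    have "coprime (?f e) (int d)"
      using e(2) by (simp add: A_set_def coprime_iff_gcd_eq_1)
    then have "coprime e (int d)"
      by (simp add: coprime_mult_left_iff)
    then have "gcd c (int M) = int g"
      using M(2) e(1) gcd_mult_distrib_int[of "int g" e "int d"]
      by (simp add: coprime_iff_gcd_eq_1 mult.commute)
    moreover have "c * int M - r \<in> A_set (Suc n) M"
      using A_set_Suc_iff[OF M r(1,2) calculation e(1)] r(3) e(2) e(1) unfolding f by simp
    moreover have "c \<in> {0..<int M ^ Suc n}"
      using e(3) pos unfolding MN e(1) by (simp del: of_nat_power power_Suc)
    ultimately show "c \<in> ?C" by simp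
  qed
  moreover have "inj_on (\<lambda>e. int g * e) (?S \<inter> {0..<int (g ^ n) * ?N})"
    using pos by (auto simp: inj_on_def)
  ultimately have "card ?C = card (?S \<inter> {0..<int (g ^ n) * ?N})"
    by (simp only: card_image)
  also have "\<dots> = g ^ n * card (?S \<inter> {0..<?N})"
  proof (rule card_periodic_mult[OF _ N])
    show "periodic_mod ?N ?S"
      unfolding periodic_mod_def
    proof (intro allI impI)
      fix x y assume xy: "[x = y] (mod ?N)" "x \<in> ?S"
      have "[?f x = ?f y] (mod ?N)"
        by (intro cong_mult cong_diff cong_refl xy)
      with xy show "y \<in> ?S"
        using periodic_modD[OF per] by auto
    qed
  qed
  also have "?S \<inter> {0..<?N} = {e \<in> {0..<?N}. ?f e \<in> A_set n d}"
    by auto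
  also have "card \<dots> = card (A_set n d \<inter> {0..<?N})"
  proof (rule card_complete_residue_system[OF per N])
    show "x = y" if "x \<in> {0..<?N}" "y \<in> {0..<?N}" "[?f x = ?f y] (mod ?N)" for x y
      using quadratic_inj_mod_power[OF cop that(3)] that(1,2) by (simp add: cong_def)
  qed auto
  also have "\<dots> = A_count n d"
    using A_count_eq_card pos by simp
  finally show ?thesis by simp
qed

text \<open>The ceilings are sorted by \<open>gcd c M\<close>, written as \<open>M div d\<close>.
  The resulting sum does not involve \<open>r\<close>.\<close>

lemma card_ceilings:
  fixes M n :: nat and r :: int
  assumes M: "M > 1" and r: "0 \<le> r" "r < int M" "coprime r (int M)"
  shows "card {c \<in> {0..<int M ^ Suc n}. c * int M - r \<in> A_set (Suc n) M}
    = (\<Sum>d | d dvd M. A_count n d * (M div d) ^ n)"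
proof -
  let ?C = "{c \<in> {0..<int M ^ Suc n}. c * int M - r \<in> A_set (Suc n) M}"
  let ?D = "\<lambda>d. {c \<in> {0..<int M ^ Suc n}. gcd c (int M) = int (M div d) \<and>
      c * int M - r \<in> A_set (Suc n) M}"
  have "?C = (\<Union>d \<in> {d. d dvd M}. ?D d)"
  proof (intro equalityI subsetI)
    fix c assume c: "c \<in> ?C"
    obtain d g e where dge: "M = d * g" "gcd c (int M) = int g" "c = int g * e"
      using gcd_decomposition[of M c] M by auto
    have "d > 0" using M dge by (auto intro: Nat.gr0I)
    with dge c have "d dvd M" "c \<in> ?D d" by auto
    then show "c \<in> (\<Union>d \<in> {d. d dvd M}. ?D d)" by blast
  qed auto
  moreover have "card (\<Union>d \<in> {d. d dvd M}. ?D d) = (\<Sum>d | d dvd M. card (?D d))"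
  proof (rule card_UN_disjoint)
    show "finite {d. d dvd M}" using M by simp
    show "\<forall>d\<in>{d. d dvd M}. finite (?D d)"
      by (intro ballI finite_subset[OF _ finite_atLeastLessThan_int]) blast
    have "d = d'" if "d dvd M" "d' dvd M" "M div d = M div d'" for d d'
    proof -
      have "d * (M div d) = d' * (M div d)"
        using that by (metis dvd_mult_div_cancel)
      moreover have "M div d \<noteq> 0"
        using that M by (simp add: dvd_div_eq_0_iff)
      ultimately show ?thesis by simp
    qed
    then show "\<forall>d\<in>{d. d dvd M}. \<forall>d'\<in>{d. d dvd M}. d \<noteq> d' \<longrightarrow> ?D d \<inter> ?D d' = {}"
      by fastforce
  qed
  moreover have "card (?D d) = A_count n d * (M div d) ^ n" if "d dvd M" for d
    using card_ceilings_of_divisor[OF M _ r, of d "M div d"] that by simp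
  ultimately show ?thesis by simp
qed

lemma card_coprime_residues:
  assumes "M > 1"
  shows "card {r \<in> {0..<int M}. coprime r (int M)} = totient M"
proof -
  \<comment> \<open>Residues start at \<open>0\<close> whereas totatives may reach \<open>M\<close>;
    for \<open>M > 1\<close> neither endpoint is coprime to \<open>M\<close>.\<close>
  have "{r \<in> {0..<int M}. coprime r (int M)} = int ` totatives M"
  proof (intro equalityI subsetI)
    fix r assume r: "r \<in> {r \<in> {0..<int M}. coprime r (int M)}"
    then obtain k where k: "r = int k" by (auto elim: nonneg_int_cases)
    then have "k > 0" using r assms by (auto intro: Nat.gr0I)
    then show "r \<in> int ` totatives M"
      using r k by (auto simp: in_totatives_iff)
  next
    fix r assume "r \<in> int ` totatives M"
    then show "r \<in> {r \<in> {0..<int M}. coprime r (int M)}"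
      using assms totatives_less by (auto simp: in_totatives_iff)
  qed
  then show ?thesis
    by (simp add: card_image totient_def)
qed

text \<open>The \<open>M * M ^ (n + 1)\<close> numerators \<open>c * M - r\<close> represent all
  residues modulo \<open>M ^ (n + 2)\<close>, so one may count pairs: \<open>totient M\<close>
  choices of \<open>r\<close>, each with the same number of \<open>c\<close>.\<close>

lemma A_count_Suc:
  assumes M: "M > 1"
  shows "A_count (Suc n) M = totient M * (\<Sum>d | d dvd M. A_count n d * (M div d) ^ n)"
proof -
  let ?A = "A_set (Suc n) M"
  let ?N = "int M ^ Suc n"
  let ?X = "{0..<int M} \<times> {0..<?N}"
  let ?a = "\<lambda>(r, c). c * int M - r"
  let ?R = "{r \<in> {0..<int M}. coprime r (int M)}"
  let ?C = "\<lambda>r. {c \<in> {0..<?N}. c * int M - r \<in> ?A}"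
  have per: "periodic_mod (int M ^ Suc (Suc n)) ?A"
    using M by (intro periodic_A_set) simp
  have "A_count (Suc n) M = card (?A \<inter> {0..<int M ^ Suc (Suc n)})"
    using A_count_eq_card M by simp
  also have "\<dots> = card {x \<in> ?X. ?a x \<in> ?A}"
  proof (rule card_complete_residue_system[OF per, symmetric])
    show "card ?X = nat (int M ^ Suc (Suc n))"
      by (simp add: nat_mult_distrib nat_power_eq)
    show "x = y" if xy: "x \<in> ?X" "y \<in> ?X" "[?a x = ?a y] (mod int M ^ Suc (Suc n))" for x y
    proof -
      obtain r c r' c' where [simp]: "x = (r, c)" "y = (r', c')"
        by (cases x, cases y) auto
      have cong: "[c * int M - r = c' * int M - r'] (mod int M ^ Suc (Suc n))"
        using xy by simp
      \<comment> \<open>Reduction modulo \<open>M\<close> identifies \<open>r\<close>; cancelling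
        one factor \<open>M\<close> then identifies \<open>c\<close> modulo
        \<open>M ^ (n + 1)\<close>.\<close>
      then have "[c * int M - r = c' * int M - r'] (mod int M)"
        by (rule cong_dvd_modulus) simp
      then have "int M dvd (c - c') * int M - (r - r')"
        by (simp add: cong_iff_dvd_diff algebra_simps)
      then have "int M dvd r - r'"
        using dvd_diff_right_iff by (metis dvd_triv_right dvd_diff_commute)
      then have r: "r = r'"
        using xy by (simp flip: cong_iff_dvd_diff) (simp add: cong_def)
      with cong have "int M * ?N dvd int M * (c - c')"
        by (simp add: cong_iff_dvd_diff algebra_simps)
      then have "?N dvd c - c'"
        using M by (simp del: power_Suc)
      then have "c = c'"
        using xy by (simp flip: cong_iff_dvd_diff del: power_Suc) (simp add: cong_def)
      with r show ?thesis by simp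
    qed
  qed (use M in auto)
  also have "{x \<in> ?X. ?a x \<in> ?A} = Sigma ?R ?C"
  proof -
    have "coprime r (int M)" if "0 \<le> r" "r < int M" "c * int M - r \<in> ?A" for r c
    proof -
      obtain d g e where "M = d * g" "gcd c (int M) = int g" "c = int g * e"
        using gcd_decomposition[of M c] M by auto
      with A_set_Suc_iff[OF M _ that(1,2)] that(3) show ?thesis by blast
    qed
    then show ?thesis by auto
  qed
  also have "card (Sigma ?R ?C) = (\<Sum>r\<in>?R. card (?C r))"
    by (intro card_SigmaI ballI finite_subset[OF Collect_restrict finite_atLeastLessThan_int])
  also have "\<dots> = (\<Sum>r\<in>?R. \<Sum>d | d dvd M. A_count n d * (M div d) ^ n)"
    using card_ceilings[OF M] by (intro sum.cong) auto
  finally show ?thesis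
    using card_coprime_residues[OF M] by simp
qed

lemma A_count_Suc_1: "A_count (Suc n) 1 = 0"
  using A_count_eq_card[of 1 "Suc n"] A_set_Suc_1 by simp

theorem theorem2p3:
  fixes M n :: nat
  assumes "M \<ge> 1" and "n \<ge> 1" and "M > 1 \<or> n > 1"
  shows "A_count n M = totient M * (\<Sum>d | d dvd M. A_count (n - 1) d * (M div d) ^ (n - 1))"
proof (cases "M > 1")
  case True
  then show ?thesis
    using A_count_Suc[of M "n - 1"] assms by simp
next
  case False
  \<comment> \<open>With \<open>M = 1\<close> the only divisor is \<open>1\<close>, and
    \<open>n - 1\<close> is still positive, so both sides vanish.\<close>
  then obtain k where "M = 1" "n = Suc (Suc k)"
    using assms by (auto dest: less_imp_Suc_add)
  then show ?thesis
    using A_count_Suc_1[of k] A_count_Suc_1[of "Suc k"] by simp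
qed

end
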